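(* Let $\mathcal A\subset\mathbb{C}$ be a finite set and let $b\in\mathcal A^{\mathbb{Z}}$. If $\boldsymbol{\mathfrak a}\in X_b$ for every $\mathfrak a\in\mathcal A$, then $$\overline{W(A_b)}=\mathrm{conv}\bigl(\sigma(A_b)\bigr).$$
   Context: For $b=(b_i)_{i\in\mathbb{Z}}\in\mathcal A^{\mathbb{Z}}$, $A_b\colon \ell^2(\mathbb{Z})\to\ell^2(\mathbb{Z})$ (complex scalars) denotes the bounded tridiagonal operator $(A_bx)_k=b_{k-1}x_{k-1}+x_{k+1}$ for $k\in\mathbb{Z}$. For $\mathfrak a\in\mathcal A$, $\boldsymbol{\mathfrak a}$ is the constant biinfinite sequence with all entries $\mathfrak a$. The numerical range of an operator $A$ is $W(A)=\{\langle Ax,x\rangle : x\in\ell^2(\mathbb{Z}),\ \|x\|=1\}$, where $\langle x,y\rangle=\sum_{k}x_k\overline{y_k}$; $\sigma(A)$ is the spectrum of $A$; $\mathrm{conv}$ denotes the convex hull, and $\overline{S}$ the closure of $S$. The shift map $\varphi$ on $\mathcal A^{\mathbb{Z}}$ is $\varphi(b)_i=b_{i+1}$; $\mathrm{orb}(b)=\{\varphi^n(b):n\in\mathbb{Z}\}$; the subshift generated by $b$ is $X_b=\overline{\mathrm{orb}(b)}$, the closure in $\mathcal A^{\mathbb{Z}}$ with the product topology of the discrete topology on $\mathcal A$ (equivalently, two sequences are close when they agree on a long central block of coordinates $[-k,k]$). *)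

theory Defs
  imports "HOL-Analysis.Analysis"
begin

definition ell2 :: "(int \<Rightarrow> complex) set" where
  "ell2 = {x. (\<lambda>k. (cmod (x k))\<^sup>2) summable_on UNIV}"

definition ell2_norm :: "(int \<Rightarrow> complex) \<Rightarrow> real" where
  "ell2_norm x = sqrt (\<Sum>\<^sub>\<infinity>k. (cmod (x k))\<^sup>2)"

definition ell2_inner :: "(int \<Rightarrow> complex) \<Rightarrow> (int \<Rightarrow> complex) \<Rightarrow> complex" where
  "ell2_inner x y = (\<Sum>\<^sub>\<infinity>k. x k * cnj (y k))"

text \<open>Operators on \<open>ell2\<close> are represented by functions on all sequences; only their
  values on \<open>ell2\<close> are relevant.\<close>

definition ell2_bounded_op :: "((int \<Rightarrow> complex) \<Rightarrow> (int \<Rightarrow> complex)) \<Rightarrow> bool" where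
  "ell2_bounded_op T \<longleftrightarrow>
     (\<forall>x\<in>ell2. T x \<in> ell2) \<and>
     (\<forall>x\<in>ell2. \<forall>y\<in>ell2. T (\<lambda>k. x k + y k) = (\<lambda>k. T x k + T y k)) \<and>
     (\<forall>c. \<forall>x\<in>ell2. T (\<lambda>k. c * x k) = (\<lambda>k. c * T x k)) \<and>
     (\<exists>K. \<forall>x\<in>ell2. ell2_norm (T x) \<le> K * ell2_norm x)"

definition ell2_invertible :: "((int \<Rightarrow> complex) \<Rightarrow> (int \<Rightarrow> complex)) \<Rightarrow> bool" where
  "ell2_invertible T \<longleftrightarrow>
     (\<exists>S. ell2_bounded_op S \<and> (\<forall>x\<in>ell2. S (T x) = x \<and> T (S x) = x))"

definition ell2_spectrum :: "((int \<Rightarrow> complex) \<Rightarrow> (int \<Rightarrow> complex)) \<Rightarrow> complex set" where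
  "ell2_spectrum T = {z. \<not> ell2_invertible (\<lambda>x k. T x k - z * x k)}"

definition numerical_range :: "((int \<Rightarrow> complex) \<Rightarrow> (int \<Rightarrow> complex)) \<Rightarrow> complex set" where
  "numerical_range T = {ell2_inner (T x) x | x. x \<in> ell2 \<and> ell2_norm x = 1}"

definition tridiag_op :: "(int \<Rightarrow> complex) \<Rightarrow> (int \<Rightarrow> complex) \<Rightarrow> (int \<Rightarrow> complex)" where
  "tridiag_op b x = (\<lambda>k. b (k - 1) * x (k - 1) + x (k + 1))"

definition shift :: "(int \<Rightarrow> 'a) \<Rightarrow> (int \<Rightarrow> 'a)" where
  "shift b = (\<lambda>i. b (i + 1))"

definition shift_orbit :: "(int \<Rightarrow> 'a) \<Rightarrow> (int \<Rightarrow> 'a) set" where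
  "shift_orbit b = range (\<lambda>n::nat. (shift ^^ n) b) \<union> range (\<lambda>n::nat. (inv shift ^^ n) b)"

definition generated_subshift :: "'a set \<Rightarrow> (int \<Rightarrow> 'a) \<Rightarrow> (int \<Rightarrow> 'a) set" where
  "generated_subshift A b =
     product_topology (\<lambda>_::int. discrete_topology A) UNIV closure_of shift_orbit b"

lemma funpow_shift: "(shift ^^ n) b = (\<lambda>i. b (i + int n))"
  by (induction n) (simp_all add: shift_def algebra_simps)

lemma inv_shift: "inv shift b = (\<lambda>i. b (i - 1))"
proof (rule inv_f_eq)
  show "inj (shift :: (int \<Rightarrow> 'a) \<Rightarrow> _)"
  proof (rule injI)
    fix x y :: "int \<Rightarrow> 'a" assume "shift x = shift y"
    then have "x (i - 1 + 1) = y (i - 1 + 1)" for i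
      unfolding shift_def by meson
    then show "x = y" by auto
  qed
qed (simp add: shift_def)

lemma funpow_inv_shift: "(inv shift ^^ n) b = (\<lambda>i. b (i - int n))"
  by (induction n) (simp_all add: inv_shift algebra_simps)

lemma shift_orbit_eq: "shift_orbit b = range (\<lambda>n i. b (i + n))"
proof -
  have "(\<lambda>i. b (i + n)) \<in> shift_orbit b" for n
  proof (cases "n \<ge> 0")
    case True
    then have "(\<lambda>i. b (i + n)) = (shift ^^ nat n) b" by (simp add: funpow_shift)
    then show ?thesis unfolding shift_orbit_def by blast
  next
    case False
    then have "(\<lambda>i. b (i + n)) = (inv shift ^^ nat (- n)) b" by (simp add: funpow_inv_shift)
    then show ?thesis unfolding shift_orbit_def by blast
  qed
  moreover have "(\<lambda>i. b (i - int n)) \<in> range (\<lambda>n i. b (i + n))" for n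
    by (rule range_eqI[of _ _ "- int n"]) simp
  ultimately show ?thesis
    by (auto simp: shift_orbit_def funpow_shift funpow_inv_shift)
qed

lemma tridiag_op_bounded:
  assumes "finite A" "\<And>i. b i \<in> A"
  shows "ell2_bounded_op (tridiag_op b)"
proof -
  have "bounded A" using assms(1) by (rule finite_imp_bounded)
  then obtain C where C: "C > 0" "\<And>a. a \<in> A \<Longrightarrow> cmod a \<le> C"
    using bounded_pos by blast
  define K where "K = 2 * C\<^sup>2 + 2"
  have main: "tridiag_op b x \<in> ell2 \<and> ell2_norm (tridiag_op b x) \<le> sqrt K * ell2_norm x"
    if x: "x \<in> ell2" for x
  proof -
    define f where "f k = (cmod (x k))\<^sup>2" for k
    have f: "f summable_on UNIV" using x by (simp add: ell2_def f_def[abs_def])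
    have reix: "((\<lambda>k. f (k + m)) has_sum infsum f UNIV) UNIV" for m :: int
    proof -
      have "bij_betw (\<lambda>k. k + m) UNIV UNIV"
        by (rule bij_betwI[where g = "\<lambda>k. k - m"]) auto
      then show ?thesis
        using has_sum_reindex_bij_betw[of "\<lambda>k. k + m" UNIV UNIV f] has_sum_infsum[OF f] by blast
    qed
    let ?g = "\<lambda>k. 2 * C\<^sup>2 * f (k + - 1) + 2 * f (k + 1)"
    have g: "(?g has_sum (2 * C\<^sup>2 * infsum f UNIV + 2 * infsum f UNIV)) UNIV"
      by (intro has_sum_add has_sum_cmult_right reix)
    have le: "(cmod (tridiag_op b x k))\<^sup>2 \<le> ?g k" for k
    proof -
      have "cmod (tridiag_op b x k) \<le> C * cmod (x (k - 1)) + cmod (x (k + 1))"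
        unfolding tridiag_op_def
        by (rule norm_triangle_le) (simp add: norm_mult mult_right_mono C(2) assms(2))
      then have "(cmod (tridiag_op b x k))\<^sup>2 \<le> (C * cmod (x (k - 1)) + cmod (x (k + 1)))\<^sup>2"
        by (rule power_mono) simp
      also have "\<dots> \<le> 2 * (C * cmod (x (k - 1)))\<^sup>2 + 2 * (cmod (x (k + 1)))\<^sup>2"
        using sum_squares_bound[of "C * cmod (x (k - 1))" "cmod (x (k + 1))"]
        by (simp add: power2_sum)
      finally show ?thesis by (simp add: f_def power_mult_distrib)
    qed
    have s: "(\<lambda>k. (cmod (tridiag_op b x k))\<^sup>2) summable_on UNIV"
      by (rule summable_on_comparison_test[of ?g])
         (use g le in \<open>auto intro: has_sum_imp_summable\<close>)
    have "(\<Sum>\<^sub>\<infinity>k. (cmod (tridiag_op b x k))\<^sup>2) \<le> 2 * C\<^sup>2 * infsum f UNIV + 2 * infsum f UNIV"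
      using has_sum_mono[OF has_sum_infsum[OF s] g] le by blast
    also have "\<dots> = K * infsum f UNIV" by (simp add: K_def algebra_simps)
    finally show ?thesis
      using s unfolding ell2_norm_def ell2_def f_def by (simp flip: real_sqrt_mult)
  qed
  show ?thesis
    unfolding ell2_bounded_op_def
  proof (intro conjI)
    show "\<exists>K. \<forall>x\<in>ell2. ell2_norm (tridiag_op b x) \<le> K * ell2_norm x"
      using main by blast
  qed (use main in \<open>auto simp: tridiag_op_def fun_eq_iff algebra_simps\<close>)
qed

end

theory Submission
  imports Defs
begin

text \<open>
  Put $E_a = \{a \bar w + w : |w| = 1\}$, an ellipse (possibly degenerate); it is the spectrum of
  the tridiagonal operator with constant coefficients $a$. Both sides of the claimed equation
  coincide with $K$, the convex hull of the union of the $E_a$ over $a \in A$, because of the cycle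
  \[ \overline{W(A_b)} \subseteq K \subseteq \mathrm{conv}\,\sigma(A_b)
     \subseteq \overline{W(A_b)}. \]

  The first inclusion compares half planes. Multiplying by $\bar c$ and taking real parts
  collects the two off-diagonals into the single form
  $\sum_k \mathrm{Re}((\bar c b_k + c) x_k \bar x_{k+1})$, which is at least
  $-\max_a |\bar c a + c|$ for a unit vector $x$; this number is exactly the minimum of
  $\mathrm{Re}(\bar c z)$ over the ellipses (\<open>numerical_range_tridiag_subset\<close>).

  The second inclusion uses the hypothesis on the subshift: $b$ contains arbitrarily long runs of
  each letter $a$, and on such a run the plane wave $k \mapsto w^k$ is an eigenvector of $A_b$ for
  $a \bar w + w$ up to an error at the ends of the run
  (\<open>symbol_ellipse_subset_spectrum\<close>).

  The third inclusion holds for every bounded operator: the numerical range is convex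
  (\<open>convex_numerical_range\<close>, the Toeplitz--Hausdorff theorem), and a point separated from its
  closure by a line is not in the spectrum since the shifted and rotated operator is coercive
  (\<open>spectrum_subset_closure_numerical_range\<close>). Coercive operators are inverted by a Neumann
  series.
\<close>

section \<open>The Hilbert space of square-summable sequences\<close>

lemma ell2_norm_nonneg: "0 \<le> ell2_norm x"
  by (simp add: ell2_norm_def infsum_nonneg)

lemma ell2_norm_power2: "(ell2_norm x)\<^sup>2 = (\<Sum>\<^sub>\<infinity>k. (cmod (x k))\<^sup>2)"
  by (simp add: ell2_norm_def infsum_nonneg)

lemma L2_set_le_ell2_norm:
  assumes "x \<in> ell2" "finite F"
  shows "L2_set (\<lambda>k. cmod (x k)) F \<le> ell2_norm x"
  unfolding L2_set_def ell2_norm_def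
  by (intro real_sqrt_le_mono finite_sum_le_infsum) (use assms in \<open>auto simp: ell2_def\<close>)

lemma cmod_le_ell2_norm: "x \<in> ell2 \<Longrightarrow> cmod (x k) \<le> ell2_norm x"
  using L2_set_le_ell2_norm[of x "{k}"] by simp

text \<open>Bounds on all finite sections pass to pointwise limits, so this criterion does the work of
  Fatou's lemma and of completeness: it puts the pointwise sum of a Neumann series in \<open>ell2\<close>. It
  also transfers the triangle inequality from finite sections.\<close>

lemma ell2_bounded_by_finite_sections:
  assumes C: "0 \<le> C" and le: "\<And>F. finite F \<Longrightarrow> L2_set (\<lambda>k. cmod (x k)) F \<le> C"
  shows "x \<in> ell2" "ell2_norm x \<le> C"
proof -
  have fin: "(\<Sum>k\<in>F. (cmod (x k))\<^sup>2) \<le> C\<^sup>2" if "finite F" for F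
    using le[OF that] unfolding L2_set_def by (rule sqrt_le_D)
  have summ: "(\<lambda>k. (cmod (x k))\<^sup>2) summable_on UNIV"
    by (rule nonneg_bdd_above_summable_on) (auto intro!: bdd_aboveI2[of _ _ "C\<^sup>2"] fin)
  then show "x \<in> ell2" by (simp add: ell2_def)
  have "(\<Sum>\<^sub>\<infinity>k. (cmod (x k))\<^sup>2) \<le> C\<^sup>2"
    by (rule infsum_le_finite_sums[OF summ]) (rule fin)
  then show "ell2_norm x \<le> C"
    unfolding ell2_norm_def using C by (rule real_le_lsqrt[rotated -1])
qed

lemma
  assumes "x \<in> ell2" "y \<in> ell2"
  shows ell2_add: "(\<lambda>k. x k + y k) \<in> ell2"
    and ell2_norm_triangle: "ell2_norm (\<lambda>k. x k + y k) \<le> ell2_norm x + ell2_norm y"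
proof -
  have "L2_set (\<lambda>k. cmod (x k + y k)) F \<le> ell2_norm x + ell2_norm y" if "finite F" for F
  proof -
    have "L2_set (\<lambda>k. cmod (x k + y k)) F \<le> L2_set (\<lambda>k. cmod (x k) + cmod (y k)) F"
      by (rule L2_set_mono) (auto intro: norm_triangle_ineq)
    also have "\<dots> \<le> L2_set (\<lambda>k. cmod (x k)) F + L2_set (\<lambda>k. cmod (y k)) F"
      by (rule L2_set_triangle_ineq)
    also have "\<dots> \<le> ell2_norm x + ell2_norm y"
      by (intro add_mono L2_set_le_ell2_norm assms that)
    finally show ?thesis .
  qed
  note * = ell2_bounded_by_finite_sections[OF _ this]
  show "(\<lambda>k. x k + y k) \<in> ell2" "ell2_norm (\<lambda>k. x k + y k) \<le> ell2_norm x + ell2_norm y"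
    by (auto intro!: * add_nonneg_nonneg ell2_norm_nonneg)
qed

lemma ell2_scale: "x \<in> ell2 \<Longrightarrow> (\<lambda>k. c * x k) \<in> ell2"
  by (auto simp: ell2_def norm_mult power_mult_distrib intro: summable_on_cmult_right)

lemma ell2_norm_scale: "ell2_norm (\<lambda>k. c * x k) = cmod c * ell2_norm x"
  by (simp add: ell2_norm_def norm_mult power_mult_distrib infsum_cmult_right' real_sqrt_mult)

lemma ell2_inner_summable:
  assumes "x \<in> ell2" "y \<in> ell2"
  shows "(\<lambda>k. x k * cnj (y k)) summable_on UNIV"
proof -
  have "(\<lambda>k. (cmod (x k))\<^sup>2 + (cmod (y k))\<^sup>2) summable_on UNIV"
    using assms by (auto simp: ell2_def intro: summable_on_add)
  moreover have "norm (x k * cnj (y k)) \<le> (cmod (x k))\<^sup>2 + (cmod (y k))\<^sup>2" for k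
    using sum_squares_bound[of "cmod (x k)" "cmod (y k)"]
      mult_nonneg_nonneg[OF norm_ge_zero norm_ge_zero, of "x k" "y k"]
    unfolding norm_mult complex_mod_cnj by linarith
  ultimately have "(\<lambda>k. norm (x k * cnj (y k))) summable_on UNIV"
    by (rule summable_on_comparison_test) auto
  then show ?thesis by (rule abs_summable_summable)
qed

lemma ell2_inner_add_left:
  "\<lbrakk>x \<in> ell2; y \<in> ell2; z \<in> ell2\<rbrakk> \<Longrightarrow>
     ell2_inner (\<lambda>k. x k + y k) z = ell2_inner x z + ell2_inner y z"
  by (simp add: ell2_inner_def distrib_right infsum_add ell2_inner_summable)

lemma ell2_inner_add_right:
  "\<lbrakk>x \<in> ell2; y \<in> ell2; z \<in> ell2\<rbrakk> \<Longrightarrow>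
     ell2_inner z (\<lambda>k. x k + y k) = ell2_inner z x + ell2_inner z y"
  by (simp add: ell2_inner_def distrib_left infsum_add ell2_inner_summable)

lemma ell2_inner_scale_left: "ell2_inner (\<lambda>k. c * x k) y = c * ell2_inner x y"
  by (simp add: ell2_inner_def mult.assoc infsum_cmult_right')

lemma ell2_inner_scale_right: "ell2_inner x (\<lambda>k. c * y k) = cnj c * ell2_inner x y"
  by (simp add: ell2_inner_def mult.left_commute infsum_cmult_right')

lemma ell2_inner_commute: "ell2_inner y x = cnj (ell2_inner x y)"
  by (simp add: ell2_inner_def mult.commute flip: infsum_cnj)

lemma ell2_inner_self: "ell2_inner x x = complex_of_real ((ell2_norm x)\<^sup>2)"
proof -
  have "ell2_inner x x = (\<Sum>\<^sub>\<infinity>k. complex_of_real ((cmod (x k))\<^sup>2))"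
    unfolding ell2_inner_def complex_norm_square ..
  also have "\<dots> = complex_of_real ((ell2_norm x)\<^sup>2)"
    unfolding ell2_norm_power2
    by (rule infsum_bounded_linear_strong[OF _ bounded_linear_of_real])
      (use summable_on_of_real summable_on_Re[of "\<lambda>k. complex_of_real ((cmod (x k))\<^sup>2)" UNIV]
       in \<open>auto simp del: of_real_power\<close>)
  finally show ?thesis .
qed

lemmas ell2_inner_simps =
  ell2_inner_add_left ell2_inner_add_right ell2_inner_scale_left ell2_inner_scale_right

lemma ell2_norm_power2_inner: "(ell2_norm x)\<^sup>2 = Re (ell2_inner x x)"
  by (simp add: ell2_inner_self)

lemma ell2_finite_support:
  assumes "finite F" "\<And>k. k \<notin> F \<Longrightarrow> x k = 0"
  shows "x \<in> ell2" "(ell2_norm x)\<^sup>2 = (\<Sum>k\<in>F. (cmod (x k))\<^sup>2)"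
proof -
  have "((\<lambda>k. (cmod (x k))\<^sup>2) has_sum (\<Sum>k\<in>F. (cmod (x k))\<^sup>2)) F"
    using assms(1) by (rule has_sum_finite)
  then have "((\<lambda>k. (cmod (x k))\<^sup>2) has_sum (\<Sum>k\<in>F. (cmod (x k))\<^sup>2)) UNIV"
    by (subst (asm) has_sum_cong_neutral[where T = UNIV]) (use assms(2) in auto)
  then show "x \<in> ell2" "(ell2_norm x)\<^sup>2 = (\<Sum>k\<in>F. (cmod (x k))\<^sup>2)"
    by (auto simp: ell2_def ell2_norm_power2 infsumI dest: has_sum_imp_summable)
qed

section \<open>Bounded operators\<close>

lemma ell2_bounded_opD:
  assumes "ell2_bounded_op T"
  shows "x \<in> ell2 \<Longrightarrow> T x \<in> ell2"
    and "\<lbrakk>x \<in> ell2; y \<in> ell2\<rbrakk> \<Longrightarrow> T (\<lambda>k. x k + y k) = (\<lambda>k. T x k + T y k)"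
    and "x \<in> ell2 \<Longrightarrow> T (\<lambda>k. c * x k) = (\<lambda>k. c * T x k)"
  using assms by (auto simp: ell2_bounded_op_def)

text \<open>The lower bound \<open>L\<close> lets the norm bound be chosen nonnegative, or above a coercivity
  constant.\<close>

lemma ell2_bounded_op_bound:
  assumes "ell2_bounded_op T"
  obtains K where "K \<ge> L" "\<And>x. x \<in> ell2 \<Longrightarrow> ell2_norm (T x) \<le> K * ell2_norm x"
proof -
  obtain K where K: "\<And>x. x \<in> ell2 \<Longrightarrow> ell2_norm (T x) \<le> K * ell2_norm x"
    using assms unfolding ell2_bounded_op_def by blast
  have "ell2_norm (T x) \<le> max L K * ell2_norm x" if "x \<in> ell2" for x
    by (rule order_trans[OF K[OF that]]) (intro mult_right_mono ell2_norm_nonneg, simp)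
  then show thesis by (intro that[of "max L K"]) auto
qed

lemma ell2_bounded_op_affine:
  assumes T: "ell2_bounded_op T"
  shows "ell2_bounded_op (\<lambda>x k. p * T x k + r * x k)"
proof -
  note T' = ell2_bounded_opD[OF T]
  obtain K where K: "\<And>x. x \<in> ell2 \<Longrightarrow> ell2_norm (T x) \<le> K * ell2_norm x"
    using ell2_bounded_op_bound[OF T] by metis
  have "ell2_norm (\<lambda>k. p * T x k + r * x k) \<le> (cmod p * K + cmod r) * ell2_norm x"
    if "x \<in> ell2" for x
  proof -
    have "ell2_norm (\<lambda>k. p * T x k + r * x k)
        \<le> ell2_norm (\<lambda>k. p * T x k) + ell2_norm (\<lambda>k. r * x k)"
      by (intro ell2_norm_triangle ell2_scale T' that)
    also have "\<dots> \<le> cmod p * (K * ell2_norm x) + cmod r * ell2_norm x"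
      unfolding ell2_norm_scale by (intro add_right_mono mult_left_mono K that) simp
    finally show ?thesis by (simp add: algebra_simps)
  qed
  then have "\<exists>K. \<forall>x\<in>ell2. ell2_norm (\<lambda>k. p * T x k + r * x k) \<le> K * ell2_norm x"
    by blast
  moreover have "\<forall>x\<in>ell2. (\<lambda>k. p * T x k + r * x k) \<in> ell2"
    by (auto intro!: ell2_add ell2_scale T'(1))
  ultimately show ?thesis
    unfolding ell2_bounded_op_def by (simp add: T'(2,3) algebra_simps)
qed

lemma ell2_invertible_scaleD:
  assumes T: "ell2_bounded_op T" and inv: "ell2_invertible (\<lambda>x k. p * T x k)"
  shows "ell2_invertible T"
proof -
  obtain S where S: "ell2_bounded_op S"
    and inv: "\<And>x. x \<in> ell2 \<Longrightarrow> S (\<lambda>k. p * T x k) = x"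
      "\<And>x. x \<in> ell2 \<Longrightarrow> (\<lambda>k. p * T (S x) k) = x"
    using inv by (auto simp: ell2_invertible_def)
  have "ell2_bounded_op (\<lambda>x k. p * S x k)"
    using ell2_bounded_op_affine[OF S, of p 0] by simp
  then show ?thesis
    unfolding ell2_invertible_def
    using inv ell2_bounded_opD[OF S] ell2_bounded_opD[OF T]
    by (intro exI[of _ "\<lambda>x k. p * S x k"]) (auto simp flip: inv)
qed

section \<open>Convexity of the numerical range\<close>

lemma mem_numerical_rangeI:
  fixes \<mu> :: complex
  assumes T: "ell2_bounded_op T" and z: "z \<in> ell2" "ell2_norm z \<noteq> 0"
    and eq: "ell2_inner (T z) z = \<mu> * (ell2_norm z)\<^sup>2"
  shows "\<mu> \<in> numerical_range T"
proof -
  define c where "c = complex_of_real (1 / ell2_norm z)"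
  let ?v = "\<lambda>k. c * z k"
  have "ell2_inner (T ?v) ?v = c * (cnj c * ell2_inner (T z) z)"
    by (simp add: ell2_bounded_opD[OF T] z ell2_inner_simps)
  also have "\<dots> = \<mu>"
    using z(2) by (simp add: eq c_def power2_eq_square)
  finally have "ell2_inner (T ?v) ?v = \<mu>" .
  moreover have "ell2_norm ?v = 1"
    unfolding ell2_norm_scale c_def norm_of_real using z(2) ell2_norm_nonneg[of z] by simp
  ultimately show ?thesis
    unfolding numerical_range_def using ell2_scale[OF z(1), of c] by force
qed

text \<open>The Toeplitz--Hausdorff theorem. Let unit vectors \<open>x\<close>, \<open>y\<close> give the distinct values \<open>\<alpha>\<close>, \<open>\<beta>\<close>, and
  let $B = (T - \alpha) / (\beta - \alpha)$, which takes the values $0$ and $1$ there. Rotating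
  \<open>x\<close> by a suitable unimodular \<open>c\<close> makes the cross term
  $\langle B(cx), y\rangle + \langle By, cx\rangle$ real. Along the segment from $cx$ to $y$ the
  normalised form of \<open>B\<close> is then a continuous real function going from $0$ to $1$, and the
  intermediate value theorem gives every point between \<open>\<alpha>\<close> and \<open>\<beta>\<close>.\<close>

theorem convex_numerical_range:
  assumes T: "ell2_bounded_op T"
  shows "convex (numerical_range T)"
proof (rule convexI)
  fix \<alpha> \<beta> :: complex and s u :: real
  assume "\<alpha> \<in> numerical_range T" "\<beta> \<in> numerical_range T"
    and su: "0 \<le> s" "0 \<le> u" "s + u = 1"
  then obtain x y where x: "x \<in> ell2" "ell2_norm x = 1" "ell2_inner (T x) x = \<alpha>"
    and y: "y \<in> ell2" "ell2_norm y = 1" "ell2_inner (T y) y = \<beta>"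
    by (auto simp: numerical_range_def)
  note T' = ell2_bounded_opD[OF T]
  show "s *\<^sub>R \<alpha> + u *\<^sub>R \<beta> \<in> numerical_range T"
  proof (cases "\<alpha> = \<beta>")
    case True
    then show ?thesis
      using su \<open>\<alpha> \<in> numerical_range T\<close> by (simp flip: scaleR_add_left)
  next
    case False
    \<comment> \<open>The cross terms $\langle Bx, y\rangle$ and $\langle By, x\rangle$.\<close>
    define p where "p = (ell2_inner (T x) y - \<alpha> * ell2_inner x y) / (\<beta> - \<alpha>)"
    define q where "q = (ell2_inner (T y) x - \<alpha> * ell2_inner y x) / (\<beta> - \<alpha>)"
    \<comment> \<open>The imaginary part equals that of $c(p - \bar q)$, so the phase of $p - \bar q$ must be cancelled.\<close>
    obtain c where c: "cmod c = 1" "Im (c * p + cnj c * q) = 0"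
    proof (cases "p = cnj q")
      case True
      then show ?thesis by (intro that[of 1]) auto
    next
      case False
      define c where "c = cnj (sgn (p - cnj q))"
      have "Im (cnj v * v) = 0" for v by simp
      from this[of "p - cnj q"] have "Im (c * (p - cnj q)) = 0"
        by (simp add: c_def sgn_eq)
      moreover have "Im (c * p + cnj c * q) = Im (c * (p - cnj q))"
        by (simp add: algebra_simps)
      ultimately show ?thesis
        using False by (intro that[of c]) (simp_all add: c_def norm_sgn)
    qed
    define \<rho> where "\<rho> = Re (c * p + cnj c * q)"
    have \<rho>: "c * p + cnj c * q = of_real \<rho>"
      using c(2) by (simp add: \<rho>_def complex_eq_iff)
    have cc: "c * cnj c = 1" using c(1) by (simp add: complex_norm_square[symmetric])
    have xx: "ell2_inner x x = 1" and yy: "ell2_inner y y = 1"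
      using x y by (simp_all add: ell2_inner_self)
    define z where "z t = (\<lambda>k. (complex_of_real (1 - t) * c) * x k + complex_of_real t * y k)" for t
    have z: "z t \<in> ell2" for t
      unfolding z_def by (intro ell2_add ell2_scale x y)
    have Tz: "T (z t) = (\<lambda>k. (complex_of_real (1 - t) * c) * T x k + complex_of_real t * T y k)" for t
      unfolding z_def by (simp add: T' ell2_scale x y del: of_real_diff)
    define N where "N t = (ell2_norm (z t))\<^sup>2" for t
    have N: "complex_of_real (N t) = (1 - t)\<^sup>2 + t\<^sup>2
        + t * (1 - t) * (c * ell2_inner x y + cnj c * ell2_inner y x)" for t
    proof -
      have "complex_of_real (N t) = ell2_inner (z t) (z t)"
        by (simp add: N_def ell2_inner_self)
      also have "\<dots> = (1 - t)\<^sup>2 * (c * cnj c) + t\<^sup>2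
        + t * (1 - t) * (c * ell2_inner x y + cnj c * ell2_inner y x)"
        unfolding z_def
        by (simp only: ell2_inner_simps ell2_scale ell2_add x y xx yy)
          (simp add: power2_eq_square algebra_simps)
      finally show ?thesis by (simp add: cc)
    qed
    have Q: "ell2_inner (T (z t)) (z t) = \<alpha> * N t + (\<beta> - \<alpha>) * (t\<^sup>2 + t * (1 - t) * \<rho>)" for t
    proof -
      have pq: "ell2_inner (T x) y = (\<beta> - \<alpha>) * p + \<alpha> * ell2_inner x y"
        "ell2_inner (T y) x = (\<beta> - \<alpha>) * q + \<alpha> * ell2_inner y x"
        using False by (simp_all add: p_def q_def)
      have "ell2_inner (T (z t)) (z t) = \<alpha> * ((1 - t)\<^sup>2 * (c * cnj c)) + \<beta> * t\<^sup>2
        + t * (1 - t) * (c * ell2_inner (T x) y + cnj c * ell2_inner (T y) x)"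
        unfolding Tz unfolding z_def
        by (simp only: ell2_inner_simps ell2_scale ell2_add T' x y)
          (simp add: power2_eq_square algebra_simps)
      also have "\<dots> = \<alpha> * N t + (\<beta> - \<alpha>) * (t\<^sup>2 + t * (1 - t) * (c * p + cnj c * q))"
        unfolding N pq cc by (simp add: algebra_simps)
      finally show ?thesis unfolding \<rho> by simp
    qed
    \<comment> \<open>If the segment met $0$, then \<open>x\<close> and \<open>y\<close> would be unimodular multiples of each other, which
      forces \<open>\<alpha> = \<beta>\<close>.\<close>
    have N_pos: "N t > 0" for t
    proof -
      have "N t \<noteq> 0"
      proof
        assume "N t = 0"
        then have "z t = (\<lambda>k. 0)"
          using cmod_le_ell2_norm[OF z[of t]] by (auto simp: N_def)
        then have eq: "complex_of_real t * y k = (- complex_of_real (1 - t) * c) * x k" for k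
          unfolding z_def fun_eq_iff by (metis add.commute add_eq_0_iff mult_minus_left)
        then have "ell2_norm (\<lambda>k. complex_of_real t * y k)
            = ell2_norm (\<lambda>k. (- complex_of_real (1 - t) * c) * x k)"
          by simp
        then have "\<bar>t\<bar> = \<bar>1 - t\<bar>"
          unfolding ell2_norm_scale by (simp add: x y c norm_mult del: of_real_diff)
        then have t: "t = 1 / 2" by linarith
        have y_eq: "y = (\<lambda>k. (- c) * x k)"
        proof
          show "y k = - c * x k" for k
            using eq[of k] unfolding t by simp
        qed
        have "\<beta> = - c * (cnj (- c) * \<alpha>)"
          unfolding y(3)[symmetric] y_eq T'(3)[OF x(1)] ell2_inner_scale_left
            ell2_inner_scale_right x(3) ..
        then have "\<beta> = (c * cnj c) * \<alpha>" by simp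
        then show False using False cc by simp
      qed
      then show ?thesis by (simp add: N_def)
    qed
    have s_eq: "s = 1 - u" using su(3) by simp
    define g where "g t = (t\<^sup>2 + t * (1 - t) * \<rho>) / N t" for t
    have N_real: "N = (\<lambda>t. (1 - t)\<^sup>2 + t\<^sup>2
        + t * (1 - t) * Re (c * ell2_inner x y + cnj c * ell2_inner y x))"
    proof
      fix t
      show "N t = (1 - t)\<^sup>2 + t\<^sup>2
        + t * (1 - t) * Re (c * ell2_inner x y + cnj c * ell2_inner y x)"
        using arg_cong[OF N[of t], of Re]
        by (simp del: of_real_diff of_real_mult of_real_power of_real_add)
    qed
    have "continuous_on {0..1} N"
      unfolding N_real by (intro continuous_intros)
    then have "continuous_on {0..1} g"
      unfolding g_def using N_pos by (intro continuous_intros) (auto simp: less_imp_neq[symmetric])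
    moreover have "g 0 \<le> u" "u \<le> g 1"
      using su by (auto simp: g_def N_real)
    ultimately obtain t where t: "g t = u"
      using IVT'[of g 0 u 1] by auto
    then have "t\<^sup>2 + t * (1 - t) * \<rho> = u * N t"
      using N_pos[of t] by (simp add: g_def field_simps)
    then have "ell2_inner (T (z t)) (z t) = \<alpha> * N t + (\<beta> - \<alpha>) * (u * N t)"
      unfolding Q by (simp only:)
    also have "\<dots> = (s *\<^sub>R \<alpha> + u *\<^sub>R \<beta>) * N t"
      unfolding s_eq by (simp add: scaleR_conv_of_real algebra_simps)
    finally show ?thesis
      using N_pos[of t] by (intro mem_numerical_rangeI[OF T z[of t]]) (auto simp: N_def)
  qed
qed

section \<open>The spectrum lies in the closed numerical range\<close>

text \<open>The inverse of $I - R$ is $G = \sum_n R^n$, summed coordinatewise. Splitting off the first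
  term gives $G = I + GR$, hence $G(I - R) = I$. For the other side, \<open>G\<close> and \<open>R\<close> must commute; instead
  of interchanging \<open>R\<close> with the infinite sum, the commutator $D = RG - GR$ is
  seen to satisfy $D = DR$, so $D = D R^n$, which tends to $0$.\<close>

lemma ell2_invertible_Neumann:
  assumes R: "ell2_bounded_op R" and q: "0 \<le> q" "q < 1"
    and le: "\<And>x. x \<in> ell2 \<Longrightarrow> ell2_norm (R x) \<le> q * ell2_norm x"
  shows "ell2_invertible (\<lambda>x k. x k - R x k)"
proof -
  note R' = ell2_bounded_opD[OF R]
  have pow: "(R ^^ n) x \<in> ell2" "ell2_norm ((R ^^ n) x) \<le> q ^ n * ell2_norm x"
    if x: "x \<in> ell2" for x n
  proof -
    have "(R ^^ n) x \<in> ell2 \<and> ell2_norm ((R ^^ n) x) \<le> q ^ n * ell2_norm x"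
    proof (induction n)
      case (Suc n)
      then have "ell2_norm (R ((R ^^ n) x)) \<le> q * (q ^ n * ell2_norm x)"
        using q by (intro order_trans[OF le] mult_left_mono) auto
      with Suc show ?case by (simp add: R' mult.assoc)
    qed (simp add: x)
    then show "(R ^^ n) x \<in> ell2" "ell2_norm ((R ^^ n) x) \<le> q ^ n * ell2_norm x" by auto
  qed
  have pow_add: "(R ^^ n) (\<lambda>k. x k + y k) = (\<lambda>k. (R ^^ n) x k + (R ^^ n) y k)"
    if "x \<in> ell2" "y \<in> ell2" for x y n
    by (induction n) (simp_all add: R' pow that)
  have pow_scale: "(R ^^ n) (\<lambda>k. c * x k) = (\<lambda>k. c * (R ^^ n) x k)" if "x \<in> ell2" for x c n
    by (induction n) (simp_all add: R' pow that)
  define G where "G x = (\<lambda>k. \<Sum>n. (R ^^ n) x k)" for x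
  have geo: "summable (\<lambda>n. q ^ n * C)" for C
    using q by (intro summable_mult2 summable_geometric) auto
  have summ: "summable (\<lambda>n. (R ^^ n) x k)" if "x \<in> ell2" for x k
    by (rule summable_comparison_test'[OF geo[of "ell2_norm x"], of 0])
      (rule order_trans[OF cmod_le_ell2_norm pow(2)]; simp add: that pow)
  have G: "G x \<in> ell2" "ell2_norm (G x) \<le> 1 / (1 - q) * ell2_norm x" if x: "x \<in> ell2" for x
  proof -
    define C where "C = 1 / (1 - q) * ell2_norm x"
    have C: "0 \<le> C" using q by (simp add: C_def ell2_norm_nonneg)
    have part: "(\<lambda>k. \<Sum>n<m. (R ^^ n) x k) \<in> ell2 \<and>
        ell2_norm (\<lambda>k. \<Sum>n<m. (R ^^ n) x k) \<le> (\<Sum>n<m. q ^ n * ell2_norm x)" for m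
    proof (induction m)
      case 0
      show ?case using ell2_finite_support[of "{}" "\<lambda>_. 0"] by simp
    next
      case (Suc m)
      then show ?case
        using pow[OF x, of m] by (auto intro: ell2_add order_trans[OF ell2_norm_triangle])
    qed
    have part_le: "(\<Sum>n<m. q ^ n * ell2_norm x) \<le> C" for m
      using sum_le_suminf[OF geo[of "ell2_norm x"], of "{..<m}"] q
      by (simp add: C_def ell2_norm_nonneg suminf_mult2[symmetric] suminf_geometric)
    have "L2_set (\<lambda>k. cmod (G x k)) F \<le> C" if "finite F" for F
    proof (rule LIMSEQ_le_const2)
      show "(\<lambda>m. L2_set (\<lambda>k. cmod (\<Sum>n<m. (R ^^ n) x k)) F)
          \<longlonglongrightarrow> L2_set (\<lambda>k. cmod (G x k)) F"
        unfolding L2_set_def G_def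
        by (intro tendsto_intros summable_LIMSEQ summ x)
      show "\<exists>M. \<forall>m\<ge>M. L2_set (\<lambda>k. cmod (\<Sum>n<m. (R ^^ n) x k)) F \<le> C"
        using part part_le L2_set_le_ell2_norm that by (meson order_trans)
    qed
    from ell2_bounded_by_finite_sections[OF C this]
    show "G x \<in> ell2" "ell2_norm (G x) \<le> 1 / (1 - q) * ell2_norm x" by (auto simp: C_def)
  qed
  have G_add: "G (\<lambda>k. x k + y k) = (\<lambda>k. G x k + G y k)" if "x \<in> ell2" "y \<in> ell2" for x y
    by (simp add: G_def pow_add summ suminf_add that)
  have G_scale: "G (\<lambda>k. c * x k) = (\<lambda>k. c * G x k)" if "x \<in> ell2" for x c
    by (simp add: G_def pow_scale summ suminf_mult that)
  have "ell2_bounded_op G"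
    unfolding ell2_bounded_op_def using G G_add G_scale by blast
  have split: "G x = (\<lambda>k. x k + G (R x) k)" if "x \<in> ell2" for x
  proof
    fix k
    show "G x k = x k + G (R x) k"
      using suminf_split_head[OF summ[OF that, of k]]
      by (simp add: G_def funpow_swap1)
  qed
  define D where "D x k = R (G x) k - G (R x) k" for x k
  have D_R: "D x = D (R x)" if x: "x \<in> ell2" for x
  proof
    fix k
    have "R (G x) = (\<lambda>k. R x k + R (G (R x)) k)"
      unfolding split[OF x] by (intro R'(2) G(1) R'(1) x)
    moreover have "G (R x) = (\<lambda>k. R x k + G (R (R x)) k)"
      using split R' x by blast
    ultimately show "D x k = D (R x) k" unfolding D_def by simp
  qed
  have commute: "R (G x) = G (R x)" if x: "x \<in> ell2" for x
  proof
    fix k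
    have D_pow: "D x k = D ((R ^^ n) x) k" for n
      by (induction n) (simp_all add: D_R[OF pow(1)[OF x]])
    have "cmod (D x k) \<le> 2 * (q * (1 / (1 - q))) * ell2_norm x * q ^ n" for n
    proof -
      let ?y = "(R ^^ n) x"
      have "cmod (D x k) \<le> cmod (R (G ?y) k) + cmod (G (R ?y) k)"
        using norm_triangle_ineq4 unfolding D_pow[of n] unfolding D_def .
      also have "\<dots> \<le> ell2_norm (R (G ?y)) + ell2_norm (G (R ?y))"
        by (intro add_mono cmod_le_ell2_norm R' G pow x)
      also have "\<dots> \<le> q * (1 / (1 - q) * ell2_norm ?y) + 1 / (1 - q) * (q * ell2_norm ?y)"
        using q by (intro add_mono order_trans[OF le] order_trans[OF G(2)] mult_left_mono le
            R' G pow x) auto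
      also have "\<dots> = 2 * (q * (1 / (1 - q))) * ell2_norm ?y" by simp
      also have "\<dots> \<le> 2 * (q * (1 / (1 - q))) * (q ^ n * ell2_norm x)"
        using q by (intro mult_left_mono pow x) auto
      finally show ?thesis by (simp add: mult_ac)
    qed
    moreover have "(\<lambda>n. 2 * (q * (1 / (1 - q))) * ell2_norm x * q ^ n) \<longlonglongrightarrow> 0"
      using q by (intro tendsto_mult_right_zero LIMSEQ_realpow_zero) auto
    ultimately have "cmod (D x k) \<le> 0"
      by (intro LIMSEQ_le_const) auto
    then show "R (G x) k = G (R x) k" by (simp add: D_def)
  qed
  show ?thesis
    unfolding ell2_invertible_def
  proof (intro exI[of _ G] conjI ballI)
    show "ell2_bounded_op G" by fact
    fix x :: "int \<Rightarrow> complex" assume x: "x \<in> ell2"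
    show "(\<lambda>k. G x k - R (G x) k) = x"
      using split[OF x] commute[OF x] by (simp add: fun_eq_iff)
    have "G (\<lambda>k. x k + (- 1) * R x k) = (\<lambda>k. G x k + (- 1) * G (R x) k)"
      using x R' by (subst G_add) (auto intro: ell2_scale simp only: G_scale)
    then show "G (\<lambda>k. x k - R x k) = x"
      using split[OF x] by (simp add: fun_eq_iff)
  qed
qed

text \<open>A variant of the Lax--Milgram theorem. If \<open>M\<close> bounds the norm of \<open>T\<close>, then
  $\|x - \epsilon T x\|^2 \le (1 - 2 \epsilon \delta + \epsilon^2 M^2) \|x\|^2$, and this
  factor is minimal, namely $1 - (\delta/M)^2$, for $\epsilon = \delta / M^2$. So
  $\epsilon T$ is a contractive perturbation of the identity.\<close>

lemma ell2_invertible_coercive: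
  assumes T: "ell2_bounded_op T" and \<delta>: "\<delta> > 0"
    and coercive: "\<And>x. x \<in> ell2 \<Longrightarrow> \<delta> * (ell2_norm x)\<^sup>2 \<le> Re (ell2_inner (T x) x)"
  shows "ell2_invertible T"
proof -
  obtain M where M: "M \<ge> \<delta>" "\<And>x. x \<in> ell2 \<Longrightarrow> ell2_norm (T x) \<le> M * ell2_norm x"
    using ell2_bounded_op_bound[OF T, of \<delta>] by blast
  define \<epsilon> where "\<epsilon> = \<delta> / M\<^sup>2"
  define q where "q = sqrt (1 - (\<delta> / M)\<^sup>2)"
  define R where "R x = (\<lambda>k. (- of_real \<epsilon>) * T x k + 1 * x k)" for x
  have M0: "M > 0" using M \<delta> by simp
  have "0 < \<delta> / M" "\<delta> / M \<le> 1" using M \<delta> M0 by auto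
  then have "0 < (\<delta> / M)\<^sup>2" "(\<delta> / M)\<^sup>2 \<le> 1"
    by (auto simp only: zero_less_power power_le_one intro: less_imp_le)
  then have q: "0 \<le> q" "q < 1" "q\<^sup>2 = 1 - (\<delta> / M)\<^sup>2" by (auto simp: q_def)
  have R: "ell2_bounded_op R"
    unfolding R_def by (rule ell2_bounded_op_affine[OF T])
  have "ell2_norm (R x) \<le> q * ell2_norm x" if x: "x \<in> ell2" for x
  proof (rule power2_le_imp_le)
    have Tx: "T x \<in> ell2" using ell2_bounded_opD[OF T] x by blast
    have "(ell2_norm (R x))\<^sup>2
        = \<epsilon>\<^sup>2 * (ell2_norm (T x))\<^sup>2 - 2 * \<epsilon> * Re (ell2_inner (T x) x) + (ell2_norm x)\<^sup>2"
      unfolding ell2_norm_power2_inner R_def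
      by (simp only: ell2_inner_simps ell2_inner_commute[of x "T x"] ell2_scale ell2_add x Tx)
        (simp add: power2_eq_square algebra_simps)
    also have "\<dots> \<le> \<epsilon>\<^sup>2 * (M * ell2_norm x)\<^sup>2 - 2 * \<epsilon> * (\<delta> * (ell2_norm x)\<^sup>2) + (ell2_norm x)\<^sup>2"
      using \<delta> M0 by (intro add_mono diff_mono mult_left_mono power_mono M coercive x)
        (auto simp: \<epsilon>_def ell2_norm_nonneg)
    also have "\<dots> = (q * ell2_norm x)\<^sup>2"
      using M0 unfolding power_mult_distrib[of q] q(3)
      by (simp add: \<epsilon>_def field_simps power2_eq_square)
    finally show "(ell2_norm (R x))\<^sup>2 \<le> (q * ell2_norm x)\<^sup>2" .
    show "0 \<le> q * ell2_norm x" using q by (simp add: ell2_norm_nonneg)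
  qed
  from ell2_invertible_Neumann[OF R q(1,2) this]
  have "ell2_invertible (\<lambda>x k. of_real \<epsilon> * T x k)" by (simp add: R_def)
  then show ?thesis by (rule ell2_invertible_scaleD[OF T])
qed

text \<open>A point \<open>z\<close> outside the closed convex set is separated from it by a line with normal \<open>c\<close>. This
  says that $\bar c\,(T - z)$ is coercive, with the width of the gap as constant.\<close>

theorem spectrum_subset_closure_numerical_range:
  assumes T: "ell2_bounded_op T"
  shows "ell2_spectrum T \<subseteq> closure (numerical_range T)"
proof
  fix z assume "z \<in> ell2_spectrum T"
  then have not_inv: "\<not> ell2_invertible (\<lambda>x k. T x k - z * x k)"
    by (simp add: ell2_spectrum_def)
  show "z \<in> closure (numerical_range T)"
  proof (rule ccontr)
    assume "z \<notin> closure (numerical_range T)"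
    then obtain c d where sep: "inner c z < d" "\<And>w. w \<in> numerical_range T \<Longrightarrow> d < inner c w"
      using separating_hyperplane_closed_point[of "closure (numerical_range T)" z]
        convex_numerical_range[OF T] closure_subset
      by (metis closed_closure convex_closure subsetD)
    define B where "B x = (\<lambda>k. T x k - z * x k)" for x
    have B: "ell2_bounded_op B"
      using ell2_bounded_op_affine[OF T, of 1 "- z"] by (simp add: B_def[abs_def])
    have "ell2_bounded_op (\<lambda>x k. cnj c * B x k)"
      using ell2_bounded_op_affine[OF B, of "cnj c" 0] by simp
    moreover have "(d - inner c z) * (ell2_norm x)\<^sup>2 \<le> Re (ell2_inner (\<lambda>k. cnj c * B x k) x)"
      if x: "x \<in> ell2" for x
    proof (cases "ell2_norm x = 0")
      case True
      have "x = (\<lambda>k. 0)"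
        using cmod_le_ell2_norm[OF x] True by auto
      then show ?thesis by (simp add: ell2_inner_def ell2_norm_def)
    next
      case False
      have Tx: "T x \<in> ell2" using ell2_bounded_opD[OF T] x by blast
      define \<mu> where "\<mu> = ell2_inner (T x) x / (ell2_norm x)\<^sup>2"
      have \<mu>: "ell2_inner (T x) x = \<mu> * (ell2_norm x)\<^sup>2" using False by (simp add: \<mu>_def)
      have "\<mu> \<in> numerical_range T"
        by (rule mem_numerical_rangeI[OF T x False \<mu>])
      then have "d \<le> inner c \<mu>" using sep(2) by force
      then have "(d - inner c z) * (ell2_norm x)\<^sup>2 \<le> (inner c \<mu> - inner c z) * (ell2_norm x)\<^sup>2"
        by (intro mult_right_mono) auto
      also have "\<dots> = Re (cnj c * ((\<mu> - z) * (ell2_norm x)\<^sup>2))"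
        by (simp add: inner_complex_def algebra_simps flip: of_real_power)
      also have "(\<mu> - z) * (ell2_norm x)\<^sup>2 = ell2_inner (\<lambda>k. T x k + (- z) * x k) x"
        by (simp only: ell2_inner_simps Tx x ell2_scale \<mu> ell2_inner_self) (simp add: algebra_simps)
      finally show ?thesis by (simp add: ell2_inner_scale_left B_def)
    qed
    ultimately have "ell2_invertible (\<lambda>x k. cnj c * B x k)"
      using sep(1) by (intro ell2_invertible_coercive[where \<delta> = "d - inner c z"]) auto
    then have "ell2_invertible B" by (rule ell2_invertible_scaleD[OF B])
    then show False using not_inv by (simp add: B_def[abs_def])
  qed
qed

section \<open>Ellipses and the tridiagonal operator\<close>

text \<open>The image of the unit circle under the symbol of the Laurent operator whose subdiagonal is
  constantly \<open>a\<close> and whose superdiagonal is $1$.\<close>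

definition symbol_ellipse :: "complex \<Rightarrow> complex set" where
  "symbol_ellipse a = (\<lambda>w. a * cnj w + w) ` sphere 0 1"

lemma compact_symbol_ellipse: "compact (symbol_ellipse a)"
  unfolding symbol_ellipse_def by (intro compact_continuous_image continuous_intros compact_sphere)

text \<open>Since $\mathrm{Re}(\bar c (a \bar w + w)) = \mathrm{Re}((\bar c a + c) \bar w)$, the
  minimum over the ellipse is $-|\bar c a + c|$, attained when \<open>w\<close> is opposite to $\bar c a + c$.\<close>

lemma symbol_ellipse_halfplane:
  assumes "\<And>z. z \<in> symbol_ellipse a \<Longrightarrow> d \<le> inner c z"
  shows "cmod (cnj c * a + c) \<le> - d"
proof -
  define v where "v = cnj c * a + c"
  define w where "w = (if v = 0 then 1 else - sgn v)"
  have "cmod w = 1" by (simp add: w_def norm_sgn)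
  then have "d \<le> inner c (a * cnj w + w)"
    by (intro assms) (auto simp: symbol_ellipse_def)
  also have "\<dots> = Re (v * cnj w)"
    by (simp add: v_def inner_complex_def algebra_simps)
  also have "\<dots> = - cmod v"
  proof (cases "v = 0")
    case False
    have "v * cnj (sgn v) = of_real (cmod v)"
      using False by (simp add: sgn_eq complex_norm_square[symmetric] power2_eq_square)
    then show ?thesis using False by (simp add: w_def)
  qed simp
  finally show ?thesis by (simp add: v_def)
qed

text \<open>Shifting the index in the subdiagonal part turns $\mathrm{Re}(\bar c \langle A_b x, x\rangle)$
  into $\sum_k \mathrm{Re}((\bar c b_k + c) x_k \bar x_{k+1})$. The coefficients have modulus at most
  $-d$, and $|x_k||x_{k+1}| \le (|x_k|^2 + |x_{k+1}|^2)/2$ sums to at most $1$.\<close>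

lemma numerical_range_tridiag_halfplane:
  assumes "finite A" "\<And>i. b i \<in> A"
    and half: "\<And>a z. \<lbrakk>a \<in> A; z \<in> symbol_ellipse a\<rbrakk> \<Longrightarrow> d \<le> inner c z"
    and \<mu>: "\<mu> \<in> numerical_range (tridiag_op b)"
  shows "d \<le> inner c \<mu>"
proof -
  obtain x where x: "x \<in> ell2" "ell2_norm x = 1" and \<mu>_eq: "\<mu> = ell2_inner (tridiag_op b x) x"
    using \<mu> by (auto simp: numerical_range_def)
  have Tx: "tridiag_op b x \<in> ell2"
    by (rule ell2_bounded_opD(1)[OF tridiag_op_bounded[of A b, OF assms(1,2)] x(1)])
  obtain C where C: "\<And>i. cmod (b i) \<le> C"
    using finite_imp_bounded[OF assms(1)] assms(2) by (auto simp: bounded_iff)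
  define f where "f k = (cmod (x k))\<^sup>2" for k
  have f: "(f has_sum 1) UNIV"
    using x ell2_norm_power2[of x] by (simp add: f_def[abs_def] ell2_def has_sum_iff)
  have reindex: "((\<lambda>k. h (k + m)) has_sum S) UNIV \<longleftrightarrow> (h has_sum S) UNIV"
    for h :: "int \<Rightarrow> real" and m S
    by (rule has_sum_reindex_bij_betw, rule bij_betwI[where g = "\<lambda>k. k - m"]) auto
  define g where "g k = inner c (b k * x k * cnj (x (k + 1)))" for k
  define h where "h k = inner c (x (k + 1) * cnj (x k))" for k
  have ff: "((\<lambda>k. (f k + f (k + 1)) / 2) has_sum 1) UNIV"
    using has_sum_cmult_left[OF has_sum_add[OF f, of "\<lambda>k. f (k + 1)" 1], of "1/2"] f
    by (simp add: reindex)
  have amgm: "cmod (x k) * cmod (x (k + 1)) \<le> (f k + f (k + 1)) / 2" for k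
    using sum_squares_bound[of "cmod (x k)" "cmod (x (k + 1))"] by (simp add: f_def)
  have tot: "((\<lambda>k. inner c (tridiag_op b x k * cnj (x k))) has_sum inner c \<mu>) UNIV"
    using has_sum_bounded_linear[OF bounded_linear_inner_right
        has_sum_infsum[OF ell2_inner_summable[OF Tx x(1)]], of c]
    by (simp add: \<mu>_eq ell2_inner_def)
  have h_summ: "h summable_on UNIV"
  proof (rule abs_summable_summable, rule Infinite_Sum.abs_summable_on_comparison_test')
    show "(\<lambda>k. cmod c * ((f k + f (k + 1)) / 2)) summable_on UNIV"
      using ff by (intro summable_on_cmult_right has_sum_imp_summable)
    show "norm (h k) \<le> cmod c * ((f k + f (k + 1)) / 2)" for k
      unfolding h_def real_norm_def
      by (rule order_trans[OF Cauchy_Schwarz_ineq2] mult_left_mono)+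
         (use amgm[of k] in \<open>auto simp: norm_mult mult.commute\<close>)
  qed
  then obtain H where H: "(h has_sum H) UNIV" by (auto simp: summable_on_def)
  have tot_split: "inner c (tridiag_op b x k * cnj (x k)) = g (k + - 1) + h k" for k
    by (simp add: tridiag_op_def g_def h_def distrib_right inner_add_right)
  have "((\<lambda>k. g (k + - 1)) has_sum (inner c \<mu> - H)) UNIV"
    using has_sum_add[OF tot has_sum_uminusI[OF H]] by (simp add: tot_split)
  then have g: "(g has_sum (inner c \<mu> - H)) UNIV" by (simp only: reindex)
  have gh: "((\<lambda>k. g k + h k) has_sum inner c \<mu>) UNIV"
    using has_sum_add[OF g H] by simp
  have "d * ((f k + f (k + 1)) / 2) \<le> g k + h k" for k
  proof -
    define v where "v = cnj c * b k + c"
    have v: "cmod v \<le> - d"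
      unfolding v_def using half assms(2) by (intro symbol_ellipse_halfplane) blast
    have "d \<le> 0" using v norm_ge_zero[of v] by linarith
    have "g k + h k = Re (v * (x k * cnj (x (k + 1))))"
      by (simp add: v_def g_def h_def inner_complex_def algebra_simps)
    also have "\<dots> \<ge> - cmod (v * (x k * cnj (x (k + 1))))"
      using abs_Re_le_cmod abs_le_D2 by (metis minus_le_iff)
    also have "- cmod (v * (x k * cnj (x (k + 1)))) = - (cmod v * (cmod (x k) * cmod (x (k + 1))))"
      by (simp add: norm_mult)
    also have "\<dots> \<ge> - ((- d) * ((f k + f (k + 1)) / 2))"
      using v \<open>d \<le> 0\<close> by (intro le_imp_neg_le mult_mono amgm) auto
    finally show ?thesis by simp
  qed
  then have "d * 1 \<le> inner c \<mu>"
    by (intro has_sum_mono[OF has_sum_cmult_right[OF ff] gh])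
  then show ?thesis by simp
qed

theorem numerical_range_tridiag_subset:
  assumes "finite A" "\<And>i. b i \<in> A"
  shows "closure (numerical_range (tridiag_op b)) \<subseteq> convex hull (\<Union>a\<in>A. symbol_ellipse a)"
proof -
  let ?K = "convex hull (\<Union>a\<in>A. symbol_ellipse a)"
  have closed: "closed ?K"
    using assms(1) by (intro compact_imp_closed compact_convex_hull compact_UN compact_symbol_ellipse)
  have "\<mu> \<in> ?K" if \<mu>: "\<mu> \<in> numerical_range (tridiag_op b)" for \<mu>
  proof (rule ccontr)
    assume "\<mu> \<notin> ?K"
    then obtain c d where sep: "inner c \<mu> < d" "\<And>z. z \<in> ?K \<Longrightarrow> d < inner c z"
      using separating_hyperplane_closed_point[of ?K \<mu>] closed by (metis convex_convex_hull)
    have "d \<le> inner c \<mu>"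
    proof (rule numerical_range_tridiag_halfplane[OF assms _ \<mu>])
      fix a z assume "a \<in> A" "z \<in> symbol_ellipse a"
      then have "z \<in> ?K" by (intro hull_inc) blast
      then show "d \<le> inner c z" using sep(2) by force
    qed
    with sep(1) show False by simp
  qed
  then show ?thesis using closed by (intro closure_minimal) auto
qed

text \<open>The sequences with value \<open>a\<close> on a window of length \<open>n + 1\<close> form a product-open neighbourhood of
  the constant sequence, so some translate of \<open>b\<close> lies in it.\<close>

lemma generated_subshift_constant_run:
  assumes const: "(\<lambda>_. a) \<in> generated_subshift A b"
  obtains m where "\<And>i. \<lbrakk>m \<le> i; i \<le> m + int n\<rbrakk> \<Longrightarrow> b i = a"
proof -
  let ?X = "product_topology (\<lambda>_::int. discrete_topology A) UNIV"
  let ?U = "PiE UNIV (\<lambda>i::int. if i \<in> {0..int n} then {a} else A)"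
  have cl: "(\<lambda>_. a) \<in> ?X closure_of shift_orbit b"
    using const unfolding generated_subshift_def .
  then have "a \<in> A" by (auto simp: in_closure_of)
  have "finite {i::int. (if i \<in> {0..int n} then {a} else A) \<noteq> topspace (discrete_topology A)}"
    by (rule finite_subset[of _ "{0..int n}"]) auto
  then have "openin ?X ?U"
    using \<open>a \<in> A\<close> by (auto simp: openin_PiE_gen)
  moreover have "(\<lambda>_. a) \<in> ?U" using \<open>a \<in> A\<close> by auto
  ultimately obtain y where "y \<in> shift_orbit b" "y \<in> ?U"
    using cl by (meson in_closure_of)
  then obtain m where m: "(\<lambda>i. b (i + m)) \<in> ?U" by (auto simp: shift_orbit_eq)
  have "b i = a" if "m \<le> i" "i \<le> m + int n" for i
    using PiE_mem[OF m, of "i - m"] that by auto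
  then show thesis by (rule that)
qed

text \<open>Restrict the plane wave $k \mapsto w^k$ to a run of \<open>n + 1\<close> letters \<open>a\<close>. Inside the run it is an
  eigenvector for $z = a \bar w + w$, so $(A_b - z)x$ lives on the four sites around the two
  ends of the run and its norm is bounded independently of \<open>n\<close>, while $\|x\|^2 = n + 1$. A bounded
  inverse of $A_b - z$ would bound \<open>n\<close>.\<close>

theorem symbol_ellipse_subset_spectrum:
  assumes "finite A" "\<And>i. b i \<in> A" and const: "(\<lambda>_. a) \<in> generated_subshift A b"
  shows "symbol_ellipse a \<subseteq> ell2_spectrum (tridiag_op b)"
proof
  fix z assume "z \<in> symbol_ellipse a"
  then obtain w where w: "cmod w = 1" "z = a * cnj w + w"
    by (auto simp: symbol_ellipse_def)
  obtain C where C: "\<And>i. cmod (b i) \<le> C"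
    using finite_imp_bounded[OF assms(1)] assms(2) by (auto simp: bounded_iff)
  have C0: "0 \<le> C" using C[of 0] norm_ge_zero order_trans by blast
  define B where "B = C + 1 + cmod z"
  show "z \<in> ell2_spectrum (tridiag_op b)"
    unfolding ell2_spectrum_def
  proof safe
    assume "ell2_invertible (\<lambda>x k. tridiag_op b x k - z * x k)"
    then obtain S where S: "ell2_bounded_op S"
      and inv: "\<And>x. x \<in> ell2 \<Longrightarrow> S (\<lambda>k. tridiag_op b x k - z * x k) = x"
      by (auto simp: ell2_invertible_def)
    obtain L where L: "L \<ge> 0" "\<And>x. x \<in> ell2 \<Longrightarrow> ell2_norm (S x) \<le> L * ell2_norm x"
      using ell2_bounded_op_bound[OF S] by blast
    have "real n \<le> L\<^sup>2 * (4 * B\<^sup>2)" for n :: nat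
    proof -
      obtain m where m: "\<And>i. \<lbrakk>m \<le> i; i \<le> m + int n\<rbrakk> \<Longrightarrow> b i = a"
        using generated_subshift_constant_run[OF const] by blast
      define I where "I = {m..m + int n}"
      define x where "x k = (if k \<in> I then w powi k else 0)" for k
      define y where "y k = tridiag_op b x k - z * x k" for k
      have x_le: "cmod (x k) \<le> 1" for k
        by (simp add: x_def norm_power_int w)
      have x: "x \<in> ell2" "(ell2_norm x)\<^sup>2 = real n + 1"
      proof -
        have "finite I" by (simp add: I_def)
        moreover have "x k = 0" if "k \<notin> I" for k using that by (simp add: x_def)
        ultimately have sup: "x \<in> ell2" "(ell2_norm x)\<^sup>2 = (\<Sum>k\<in>I. (cmod (x k))\<^sup>2)"
          using ell2_finite_support by blast+
        show "x \<in> ell2" by (rule sup)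
        have "(\<Sum>k\<in>I. (cmod (x k))\<^sup>2) = (\<Sum>k\<in>I. 1)"
          by (rule sum.cong) (auto simp: x_def norm_power_int w)
        then show "(ell2_norm x)\<^sup>2 = real n + 1" unfolding sup(2) by (simp add: I_def)
      qed
      define F where "F = {m - 1, m, m + int n, m + int n + 1}"
      have y_0: "y k = 0" if "k \<notin> F" for k
      proof (cases "k \<in> {m + 1..m + int n - 1}")
        case True
        have w0: "w \<noteq> 0" and winv: "inverse w = cnj w"
          using w(1) by (auto simp: inverse_eq_divide divide_conv_cnj)
        have "w powi (k - 1) = cnj w * w powi k" "w powi (k + 1) = w * w powi k"
          using w0 by (simp_all add: power_int_diff power_int_add winv[symmetric] field_simps)
        moreover have "b (k - 1) = a" using True by (intro m) auto
        ultimately show ?thesis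
          using True by (simp add: y_def tridiag_op_def x_def I_def w(2) algebra_simps)
      next
        case False
        with that show ?thesis
          by (auto simp: y_def tridiag_op_def x_def I_def F_def)
      qed
      have y_le: "cmod (y k) \<le> B" for k
      proof -
        have "cmod (y k) \<le> cmod (b (k - 1) * x (k - 1)) + cmod (x (k + 1)) + cmod (z * x k)"
          unfolding y_def tridiag_op_def by norm
        also have "\<dots> \<le> C * 1 + 1 + cmod z * 1"
          unfolding norm_mult by (intro add_mono mult_mono C x_le) (auto simp: C0)
        finally show ?thesis by (simp add: B_def)
      qed
      have fin: "finite F" by (simp add: F_def)
      have y: "y \<in> ell2" "(ell2_norm y)\<^sup>2 = (\<Sum>k\<in>F. (cmod (y k))\<^sup>2)"
        using ell2_finite_support[OF fin y_0] by auto
      have "card F \<le> 4" unfolding F_def by (rule card_insert_le_m1 | simp)+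
      have "(ell2_norm y)\<^sup>2 \<le> of_nat (card F) * B\<^sup>2"
        unfolding y(2) by (rule sum_bounded_above) (auto intro: power_mono y_le)
      also have "\<dots> \<le> 4 * B\<^sup>2"
        using \<open>card F \<le> 4\<close> by (intro mult_right_mono) auto
      finally have y_norm: "(ell2_norm y)\<^sup>2 \<le> 4 * B\<^sup>2" .
      have "ell2_norm x \<le> L * ell2_norm y"
        using L(2)[OF y(1)] inv[OF x(1)] by (simp add: y_def[abs_def])
      then have "(ell2_norm x)\<^sup>2 \<le> (L * ell2_norm y)\<^sup>2"
        by (rule power_mono) (rule ell2_norm_nonneg)
      also have "\<dots> \<le> L\<^sup>2 * (4 * B\<^sup>2)"
        unfolding power_mult_distrib by (intro mult_left_mono y_norm) auto
      finally show ?thesis using x(2) by simp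
    qed
    then show False
      using reals_Archimedean2[of "L\<^sup>2 * (4 * B\<^sup>2)"] by (meson not_less)
  qed
qed

theorem corollary3p8:
  fixes A :: "complex set" and b :: "int \<Rightarrow> complex"
  assumes "finite A"
    and "\<And>i. b i \<in> A"
    and "\<And>a. a \<in> A \<Longrightarrow> (\<lambda>_. a) \<in> generated_subshift A b"
  shows "closure (numerical_range (tridiag_op b)) = convex hull (ell2_spectrum (tridiag_op b))"
proof
  note T = tridiag_op_bounded[of A b, OF assms(1,2)]
  have "closure (numerical_range (tridiag_op b)) \<subseteq> convex hull (\<Union>a\<in>A. symbol_ellipse a)"
    by (rule numerical_range_tridiag_subset[OF assms(1,2)])
  also have "\<dots> \<subseteq> convex hull (ell2_spectrum (tridiag_op b))"
    using symbol_ellipse_subset_spectrum[of A b, OF assms(1,2)] assms(3)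
    by (intro hull_mono UN_least) auto
  finally show "closure (numerical_range (tridiag_op b))
      \<subseteq> convex hull (ell2_spectrum (tridiag_op b))" .
  show "convex hull (ell2_spectrum (tridiag_op b)) \<subseteq> closure (numerical_range (tridiag_op b))"
    using spectrum_subset_closure_numerical_range[OF T] convex_numerical_range[OF T]
    by (intro hull_minimal convex_closure)
qed

end
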